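(* Let $m\ge3$ be an integer and let $\beta>1$ satisfy $\beta^2=m\beta-1$. Then $L_\oplus(-\beta)=2=L_\otimes(-\beta)$.
   Context: For $\beta>1$, let $I_\beta=\big[\frac{-\beta}{\beta+1},\frac1{\beta+1}\big)$ and $T_{-\beta}:I_\beta\to I_\beta$, $T_{-\beta}(x)=-\beta x-\lfloor -\beta x+\frac{\beta}{\beta+1}\rfloor$. For $y\in I_\beta$ put $y_i=\lfloor -\beta T_{-\beta}^{i-1}(y)+\frac{\beta}{\beta+1}\rfloor$ ($i\ge1$) and $d_{-\beta}(y)=y_1y_2y_3\cdots$. The $(-\beta)$-expansion of a real $x$: take the minimal non-negative integer $j$ with $y=x(-\beta)^{-j}\in\big(\frac{-\beta}{\beta+1},\frac1{\beta+1}\big)$, compute $d_{-\beta}(y)=y_1y_2\cdots$; the expansion is $x=\sum_{i\ge1}y_i(-\beta)^{j-i}$ with digit $y_i$ the coefficient of $(-\beta)^{j-i}$. $\mathrm{Fin}(-\beta)$ is the set of reals whose $(-\beta)$-expansion has finitely many non-zero digits, and $\mathbb{Z}_{-\beta}$ (the $(-\beta)$-integers) is the set of reals whose $(-\beta)$-expansion has no non-zero digit at negative powers of $(-\beta)$ (i.e. $y_i=0$ for all $i>j$). Define $L_\oplus(-\beta)=\min\{l\in\mathbb{N}\mid \forall x,y\in\mathbb{Z}_{-\beta}:\ x+y\in\mathrm{Fin}(-\beta)\Rightarrow x+y\in(-\beta)^{-l}\mathbb{Z}_{-\beta}\}$ and $L_\otimes(-\beta)=\min\{l\in\mathbb{N}\mid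 \forall x,y\in\mathbb{Z}_{-\beta}:\ xy\in\mathrm{Fin}(-\beta)\Rightarrow xy\in(-\beta)^{-l}\mathbb{Z}_{-\beta}\}$. *)

theory Defs
  imports "HOL-Library.Extended_Nat" Complex_Main
begin

definition nb_interval :: "real \<Rightarrow> real set"
  where "nb_interval \<beta> = {- \<beta> / (\<beta> + 1) ..< 1 / (\<beta> + 1)}"

text \<open>For \<open>\<beta> > 1\<close> this maps \<open>nb_interval \<beta>\<close> to itself; only its values there matter.\<close>

definition nb_transform :: "real \<Rightarrow> real \<Rightarrow> real"
  where "nb_transform \<beta> x = - \<beta> * x - of_int \<lfloor>- \<beta> * x + \<beta> / (\<beta> + 1)\<rfloor>"

lemma nb_transform_in_interval:
  assumes "\<beta> > 1"
  shows "nb_transform \<beta> x \<in> nb_interval \<beta>"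
proof -
  have "1 / (\<beta> + 1) = 1 - \<beta> / (\<beta> + 1)"
    using assms by (simp add: field_simps)
  then show ?thesis
    unfolding nb_transform_def nb_interval_def by simp linarith
qed

text \<open>The \<open>i\<close>-th digit of \<open>d\<^bsub>-\<beta>\<^esub>(y)\<close>, where digits are numbered from \<open>1\<close>.\<close>

definition nb_digit :: "real \<Rightarrow> real \<Rightarrow> nat \<Rightarrow> int"
  where "nb_digit \<beta> y i = \<lfloor>- \<beta> * (nb_transform \<beta> ^^ (i - 1)) y + \<beta> / (\<beta> + 1)\<rfloor>"

text \<open>The scaled number is required to lie in the open interval, that is, in the interior
  of \<open>nb_interval \<beta>\<close>.\<close>

definition nb_shift :: "real \<Rightarrow> real \<Rightarrow> nat"
  where "nb_shift \<beta> x =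
    (LEAST j. x * (- \<beta>) powi (- int j) \<in> {- \<beta> / (\<beta> + 1) <..< 1 / (\<beta> + 1)})"

text \<open>For \<open>i \<ge> 1\<close>, \<open>nb_expansion \<beta> x i\<close> is the coefficient of the power
  \<open>(-\<beta>) powi (int (nb_shift \<beta> x) - int i)\<close> in the \<open>(-\<beta>)\<close>-expansion of \<open>x\<close>.\<close>

definition nb_expansion :: "real \<Rightarrow> real \<Rightarrow> nat \<Rightarrow> int"
  where "nb_expansion \<beta> x i = nb_digit \<beta> (x * (- \<beta>) powi (- int (nb_shift \<beta> x))) i"

definition nb_Fin :: "real \<Rightarrow> real set"
  where "nb_Fin \<beta> = {x. finite {i. i \<ge> 1 \<and> nb_expansion \<beta> x i \<noteq> 0}}"

definition nb_integers :: "real \<Rightarrow> real set"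
  where "nb_integers \<beta> = {x. \<forall>i > nb_shift \<beta> x. nb_expansion \<beta> x i = 0}"

definition nb_scaled_integers :: "real \<Rightarrow> nat \<Rightarrow> real set"
  where "nb_scaled_integers \<beta> l = (\<lambda>z. (- \<beta>) powi (- int l) * z) ` nb_integers \<beta>"

text \<open>The minima are taken in \<open>enat\<close>: there \<open>Inf\<close> of a nonempty set is its least element,
  while \<open>Inf {} = \<infinity>\<close>, so a finite value asserts that the minimum exists.\<close>

definition L_oplus :: "real \<Rightarrow> enat"
  where "L_oplus \<beta> = Inf (enat ` {l. \<forall>x \<in> nb_integers \<beta>. \<forall>y \<in> nb_integers \<beta>.
    x + y \<in> nb_Fin \<beta> \<longrightarrow> x + y \<in> nb_scaled_integers \<beta> l})"

definition L_otimes :: "real \<Rightarrow> enat"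
  where "L_otimes \<beta> = Inf (enat ` {l. \<forall>x \<in> nb_integers \<beta>. \<forall>y \<in> nb_integers \<beta>.
    x * y \<in> nb_Fin \<beta> \<longrightarrow> x * y \<in> nb_scaled_integers \<beta> l})"

end

theory Submission
  imports Defs
begin

text \<open>
  Let \<open>\<gamma> = 1/\<beta>\<close> be the conjugate of \<open>\<beta>\<close>. An admissible digit string never contains
  \<open>m - 1\<close> followed by \<open>0\<close>, so with \<open>A = (m - 2) / (1 - \<gamma>\<^sup>2)\<close> the conjugate of a
  \<open>(-\<beta>)\<close>-integer lies in \<open>[-\<gamma>A, A]\<close>, and it is at least \<open>\<gamma>\<^sup>2A\<close> if the last digit
  is nonzero. Hence a number with \<open>k\<close> fractional digits has a conjugate of modulus at
  least \<open>\<beta>^(k-2) * A\<close>. Sums and products of integers have conjugates of modulus at most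
  \<open>2A\<close> and \<open>A\<^sup>2\<close>, both less than \<open>\<beta>A\<close>, so \<open>k \<le> 2\<close>. Conversely, a number whose
  conjugate exceeds \<open>A\<close> needs two fractional digits; such a number is
  \<open>(m-2) + (m-2) = 2(m-2)\<close>, respectively \<open>(3\<beta>)\<^sup>2\<close> for products if \<open>m = 3\<close>.
\<close>

section \<open>Iterates of the transformation\<close>

lemma zero_in_nb_interval: "\<beta> > 1 \<Longrightarrow> 0 \<in> nb_interval \<beta>"
  by (simp add: nb_interval_def)

text \<open>The interval is half-open of length 1, so only one integer can be split off from
  \<open>- \<beta> * s\<close> with remainder in it.\<close>

lemma nb_transform_eqI:
  assumes "\<beta> > 1" "u \<in> nb_interval \<beta>" "- \<beta> * s = of_int d + u"
  shows "nb_transform \<beta> s = u"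
proof -
  have "1 / (\<beta> + 1) = 1 - \<beta> / (\<beta> + 1)"
    using assms(1) by (simp add: field_simps)
  then have "\<lfloor>- \<beta> * s + \<beta> / (\<beta> + 1)\<rfloor> = d"
    using assms(2) unfolding assms(3) nb_interval_def by (simp add: floor_eq_iff)
  then show ?thesis
    unfolding nb_transform_def using assms(3) by linarith
qed

lemma nb_transform_zero: "\<beta> > 1 \<Longrightarrow> nb_transform \<beta> 0 = 0"
  by (rule nb_transform_eqI[where d = 0]) (simp_all add: zero_in_nb_interval)

lemma nb_transform_iterate_zero: "\<beta> > 1 \<Longrightarrow> (nb_transform \<beta> ^^ n) 0 = 0"
  by (induction n) (simp_all add: nb_transform_zero)

lemma nb_transform_iterate_in_interval:
  assumes "\<beta> > 1" "y \<in> nb_interval \<beta>"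
  shows "(nb_transform \<beta> ^^ n) y \<in> nb_interval \<beta>"
  using assms by (cases n) (simp_all add: nb_transform_in_interval)

abbreviation nb_interior :: "real \<Rightarrow> real set"
  where "nb_interior \<beta> \<equiv> {- \<beta> / (\<beta> + 1) <..< 1 / (\<beta> + 1)}"

lemma nb_interior_subset: "y \<in> nb_interior \<beta> \<Longrightarrow> y \<in> nb_interval \<beta>"
  by (simp add: nb_interval_def)

text \<open>Division by \<open>- \<beta>\<close> prepends a digit 0. This needs the open interval:
  the left endpoint would be sent to the excluded right endpoint.\<close>

lemma nb_transform_iterate_div_power:
  assumes "\<beta> > 1" "y \<in> nb_interior \<beta>"
  shows "(nb_transform \<beta> ^^ (n + k)) (y / (- \<beta>) ^ k) = (nb_transform \<beta> ^^ n) y"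
proof -
  have "(nb_transform \<beta> ^^ k) (y / (- \<beta>) ^ k) = y" if "y \<in> nb_interior \<beta>" for y
    using that
  proof (induction k arbitrary: y)
    case (Suc k)
    have b: "y / - \<beta> \<in> nb_interior \<beta>"
    proof -
      have y: "- \<beta> < y * (\<beta> + 1)" "y * (\<beta> + 1) < 1"
        using Suc.prems assms(1) by (simp_all add: field_simps)
      moreover have "\<beta> * \<beta> > 1"
        using assms(1) by (metis less_1_mult)
      ultimately show ?thesis
        using assms(1) by (auto simp: field_simps)
    qed
    have "(nb_transform \<beta> ^^ Suc k) (y / (- \<beta>) ^ Suc k)
        = nb_transform \<beta> ((nb_transform \<beta> ^^ k) ((y / - \<beta>) / (- \<beta>) ^ k))"
      by (simp add: mult.commute)
    also have "\<dots> = nb_transform \<beta> (y / - \<beta>)"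
      by (simp only: Suc.IH[OF b])
    also have "\<dots> = y"
      using assms(1) nb_interior_subset[OF Suc.prems]
      by (intro nb_transform_eqI[where d = 0]) auto
    finally show ?case .
  qed simp
  then show ?thesis
    using assms(2) by (simp add: funpow_add)
qed

lemma nb_digit_Suc:
  "nb_digit \<beta> y (Suc i) = \<lfloor>- \<beta> * (nb_transform \<beta> ^^ i) y + \<beta> / (\<beta> + 1)\<rfloor>"
  by (simp add: nb_digit_def)

lemma nb_transform_iterate_Suc:
  "(nb_transform \<beta> ^^ Suc i) y = - \<beta> * (nb_transform \<beta> ^^ i) y - of_int (nb_digit \<beta> y (Suc i))"
  by (simp add: nb_digit_Suc nb_transform_def)

text \<open>If all later digits vanish, the orbit grows by the factor \<open>-\<beta>\<close> in each step
  while staying bounded, so it must be \<open>0\<close>.\<close>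

lemma nb_digits_eventually_zero_iff:
  assumes "\<beta> > 1"
  shows "(\<forall>i>n. nb_digit \<beta> y i = 0) \<longleftrightarrow> (nb_transform \<beta> ^^ n) y = 0"
proof
  assume *: "\<forall>i>n. nb_digit \<beta> y i = 0"
  let ?t = "(nb_transform \<beta> ^^ n) y"
  have iter: "(nb_transform \<beta> ^^ (n + k)) y = (- \<beta>) ^ k * ?t" for k
  proof (induction k)
    case (Suc k)
    have "(nb_transform \<beta> ^^ Suc (n + k)) y = - \<beta> * (nb_transform \<beta> ^^ (n + k)) y"
      using * by (subst nb_transform_iterate_Suc) simp
    then show ?case
      using Suc by simp
  qed simp
  have bound: "\<beta> ^ Suc k * \<bar>?t\<bar> \<le> 1" for k
  proof -
    have "(nb_transform \<beta> ^^ (n + Suc k)) y \<in> nb_interval \<beta>"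
      using nb_transform_in_interval[OF assms] by simp
    moreover have "x \<in> nb_interval \<beta> \<Longrightarrow> \<bar>x\<bar> \<le> 1" for x
    proof -
      assume "x \<in> nb_interval \<beta>"
      moreover have "\<beta> / (\<beta> + 1) \<le> 1" "1 / (\<beta> + 1) \<le> 1"
        using assms by auto
      ultimately show "\<bar>x\<bar> \<le> 1"
        unfolding nb_interval_def by auto
    qed
    ultimately have "\<bar>(- \<beta>) ^ Suc k * ?t\<bar> \<le> 1"
      unfolding iter by blast
    then show ?thesis
      using assms by (simp add: abs_mult power_abs)
  qed
  show "?t = 0"
  proof (rule ccontr)
    assume "?t \<noteq> 0"
    obtain k where "1 / \<bar>?t\<bar> < \<beta> ^ k"
      using real_arch_pow[OF assms] by blast
    also have "\<dots> \<le> \<beta> ^ Suc k"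
      using assms by simp
    finally show False
      using bound[of k] \<open>?t \<noteq> 0\<close> by (simp add: field_simps)
  qed
next
  assume *: "(nb_transform \<beta> ^^ n) y = 0"
  show "\<forall>i>n. nb_digit \<beta> y i = 0"
  proof (intro allI impI)
    fix i assume "i > n"
    then obtain k where i: "i = Suc (k + n)"
      by (metis less_iff_Suc_add add.commute)
    have "(nb_transform \<beta> ^^ (k + n)) y = 0"
      using * by (simp add: funpow_add nb_transform_iterate_zero[OF assms])
    then show "nb_digit \<beta> y i = 0"
      using assms unfolding i nb_digit_Suc by (simp add: floor_eq_iff)
  qed
qed

section \<open>Membership in the sets of integers and of finite expansions\<close>

lemma power_int_uminus_nat: "x * b powi (- int j) = x / b ^ j" for x b :: real
  by (simp add: power_int_minus divide_inverse)

lemma nb_shift_eq: "nb_shift \<beta> x = (LEAST j. x / (- \<beta>) ^ j \<in> nb_interior \<beta>)"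
  by (simp only: nb_shift_def power_int_uminus_nat)

text \<open>Growth of \<open>\<beta> ^ j\<close> makes the set under \<open>LEAST\<close> nonempty;
  1 / (\<beta> + 1) is the distance from 0 to the nearer endpoint.\<close>

lemma nb_shift_interior:
  assumes "\<beta> > 1"
  shows "x / (- \<beta>) ^ nb_shift \<beta> x \<in> nb_interior \<beta>"
proof -
  obtain j where "\<bar>x\<bar> * (\<beta> + 1) < \<beta> ^ j"
    using real_arch_pow[OF assms] by blast
  then have "\<bar>x / (- \<beta>) ^ j\<bar> < 1 / (\<beta> + 1)"
    using assms by (simp add: abs_divide power_abs field_simps)
  moreover have "1 / (\<beta> + 1) \<le> \<beta> / (\<beta> + 1)"
    using assms by (intro divide_right_mono) auto
  ultimately have "x / (- \<beta>) ^ j \<in> nb_interior \<beta>"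
    unfolding greaterThanLessThan_iff minus_divide_left[symmetric] by linarith
  then show ?thesis
    unfolding nb_shift_eq by (rule LeastI)
qed

lemma nb_integers_shift_iff:
  assumes "\<beta> > 1"
  shows "x \<in> nb_integers \<beta> \<longleftrightarrow>
    (nb_transform \<beta> ^^ nb_shift \<beta> x) (x / (- \<beta>) ^ nb_shift \<beta> x) = 0"
  unfolding nb_integers_def nb_expansion_def power_int_uminus_nat mem_Collect_eq
  using nb_digits_eventually_zero_iff[OF assms] .

lemma nb_Fin_shift_iff:
  assumes "\<beta> > 1"
  shows "x \<in> nb_Fin \<beta> \<longleftrightarrow>
    (\<exists>n. (nb_transform \<beta> ^^ n) (x / (- \<beta>) ^ nb_shift \<beta> x) = 0)"
    (is "_ \<longleftrightarrow> (\<exists>n. (_ ^^ n) ?y = 0)")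
proof -
  have "finite {i. i \<ge> 1 \<and> nb_digit \<beta> ?y i \<noteq> 0} \<longleftrightarrow> (\<exists>n. \<forall>i>n. nb_digit \<beta> ?y i = 0)"
  proof
    assume "finite {i. i \<ge> 1 \<and> nb_digit \<beta> ?y i \<noteq> 0}"
    then obtain n where n: "\<forall>i \<in> {i. i \<ge> 1 \<and> nb_digit \<beta> ?y i \<noteq> 0}. i \<le> n"
      using finite_nat_set_iff_bounded_le by blast
    have "\<forall>i>n. nb_digit \<beta> ?y i = 0"
    proof (intro allI impI, rule ccontr)
      fix i assume "i > n" "nb_digit \<beta> ?y i \<noteq> 0"
      then have "i \<in> {i. i \<ge> 1 \<and> nb_digit \<beta> ?y i \<noteq> 0}"
        by simp
      then have "i \<le> n"
        using n by blast
      then show False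
        using \<open>i > n\<close> by simp
    qed
    then show "\<exists>n. \<forall>i>n. nb_digit \<beta> ?y i = 0" ..
  next
    assume "\<exists>n. \<forall>i>n. nb_digit \<beta> ?y i = 0"
    then obtain n where "\<forall>i>n. nb_digit \<beta> ?y i = 0" ..
    then have "{i. i \<ge> 1 \<and> nb_digit \<beta> ?y i \<noteq> 0} \<subseteq> {..n}"
      by (auto simp: not_less[symmetric])
    then show "finite {i. i \<ge> 1 \<and> nb_digit \<beta> ?y i \<noteq> 0}"
      by (rule finite_subset) simp
  qed
  then show ?thesis
    by (simp only: nb_Fin_def nb_expansion_def power_int_uminus_nat mem_Collect_eq
        nb_digits_eventually_zero_iff[OF assms])
qed

text \<open>Frees both notions from the minimal shift: a larger exponent \<open>j\<close> only puts
  zeros in front of the digits.\<close>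

lemma nb_integers_iff:
  assumes "\<beta> > 1" "y \<in> nb_interior \<beta>"
  shows "y * (- \<beta>) ^ j \<in> nb_integers \<beta> \<longleftrightarrow> (nb_transform \<beta> ^^ j) y = 0"
    and "y * (- \<beta>) ^ j \<in> nb_Fin \<beta> \<longleftrightarrow> (\<exists>n. (nb_transform \<beta> ^^ n) y = 0)"
proof -
  let ?x = "y * (- \<beta>) ^ j"
  let ?s = "nb_shift \<beta> ?x"
  have "?x / (- \<beta>) ^ j \<in> nb_interior \<beta>"
    using assms by simp
  then have "?s \<le> j"
    unfolding nb_shift_eq by (rule Least_le)
  then obtain k where j: "j = ?s + k"
    using le_Suc_ex by blast
  have "y = (?x / (- \<beta>) ^ ?s) / (- \<beta>) ^ k"
    using assms(1) j by (simp flip: power_add)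
  then have iter: "(nb_transform \<beta> ^^ (n + k)) y = (nb_transform \<beta> ^^ n) (?x / (- \<beta>) ^ ?s)" for n
    using nb_transform_iterate_div_power[OF assms(1) nb_shift_interior[OF assms(1)]] by metis
  show "?x \<in> nb_integers \<beta> \<longleftrightarrow> (nb_transform \<beta> ^^ j) y = 0"
    unfolding nb_integers_shift_iff[OF assms(1)] iter[symmetric] j[symmetric] ..
  show "?x \<in> nb_Fin \<beta> \<longleftrightarrow> (\<exists>n. (nb_transform \<beta> ^^ n) y = 0)"
  proof
    assume "?x \<in> nb_Fin \<beta>"
    then show "\<exists>n. (nb_transform \<beta> ^^ n) y = 0"
      unfolding nb_Fin_shift_iff[OF assms(1)] iter[symmetric] by blast
  next
    assume "\<exists>n. (nb_transform \<beta> ^^ n) y = 0"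
    then obtain n where "(nb_transform \<beta> ^^ n) y = 0" ..
    then have "(nb_transform \<beta> ^^ (k + n)) y = 0"
      by (simp add: funpow_add nb_transform_iterate_zero[OF assms(1)])
    then show "?x \<in> nb_Fin \<beta>"
      unfolding nb_Fin_shift_iff[OF assms(1)] iter[symmetric] by (metis add.commute)
  qed
qed

lemma nb_shift_decompose:
  assumes "\<beta> > 1"
  obtains y j where "x = y * (- \<beta>) ^ j" "y \<in> nb_interior \<beta>"
  using nb_shift_interior[OF assms, of x] assms
  by (metis nonzero_eq_divide_eq power_not_zero neg_equal_0_iff_equal not_one_less_zero)

lemma zero_in_nb_integers:
  assumes "\<beta> > 1"
  shows "0 \<in> nb_integers \<beta>"
  using nb_integers_iff(1)[OF assms, of 0 0] assms by simp

lemma nb_integers_mult_power: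
  assumes "\<beta> > 1" "x \<in> nb_integers \<beta>"
  shows "(- \<beta>) ^ k * x \<in> nb_integers \<beta>"
proof -
  obtain y j where x: "x = y * (- \<beta>) ^ j" and y: "y \<in> nb_interior \<beta>"
    using nb_shift_decompose[OF assms(1)] .
  have "(nb_transform \<beta> ^^ (k + j)) y = 0"
    using assms x nb_integers_iff(1)[OF assms(1) y]
    by (simp add: funpow_add nb_transform_iterate_zero)
  then have "y * (- \<beta>) ^ (k + j) \<in> nb_integers \<beta>"
    using nb_integers_iff(1)[OF assms(1) y] by blast
  then show ?thesis
    by (simp add: x power_add mult_ac)
qed

lemma nb_Fin_obtain_scale:
  assumes "\<beta> > 1" "x \<in> nb_Fin \<beta>"
  obtains k where "(- \<beta>) ^ k * x \<in> nb_integers \<beta>"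
proof -
  obtain y j where x: "x = y * (- \<beta>) ^ j" and y: "y \<in> nb_interior \<beta>"
    using nb_shift_decompose[OF assms(1)] .
  obtain n where "(nb_transform \<beta> ^^ n) y = 0"
    using assms x nb_integers_iff(2)[OF assms(1) y] by auto
  then have "(nb_transform \<beta> ^^ (j + n)) y = 0"
    by (simp add: funpow_add nb_transform_iterate_zero[OF assms(1)])
  then have "y * (- \<beta>) ^ (j + n) \<in> nb_integers \<beta>"
    using nb_integers_iff(1)[OF assms(1) y] by blast
  then have "(- \<beta>) ^ n * x \<in> nb_integers \<beta>"
    by (simp add: x power_add mult_ac)
  then show thesis ..
qed

lemma nb_scaled_integers_iff:
  assumes "\<beta> > 1"
  shows "z \<in> nb_scaled_integers \<beta> l \<longleftrightarrow> (- \<beta>) ^ l * z \<in> nb_integers \<beta>"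
proof -
  have "z \<in> nb_scaled_integers \<beta> l \<longleftrightarrow> (\<exists>w \<in> nb_integers \<beta>. z = w / (- \<beta>) ^ l)"
    unfolding nb_scaled_integers_def image_iff mult.commute[of "_ powi _"]
      power_int_uminus_nat ..
  also have "\<dots> \<longleftrightarrow> (- \<beta>) ^ l * z \<in> nb_integers \<beta>"
    using assms by (auto simp: field_simps intro!: bexI[of _ "(- \<beta>) ^ l * z"])
  finally show ?thesis .
qed

section \<open>Finite digit strings behind the radix point in base \<open>- \<beta>\<close>\<close>

primrec nb_value :: "real \<Rightarrow> int list \<Rightarrow> real" where
  "nb_value \<beta> [] = 0"
| "nb_value \<beta> (d # ds) = (of_int d + nb_value \<beta> ds) / (- \<beta>)"

text \<open>Requiring the interior for every nonempty suffix makes each digit the one that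
  \<open>nb_transform\<close> extracts, so the string is the expansion of its value.\<close>

primrec nb_admissible :: "real \<Rightarrow> int list \<Rightarrow> bool" where
  "nb_admissible \<beta> [] \<longleftrightarrow> True"
| "nb_admissible \<beta> (d # ds) \<longleftrightarrow> nb_value \<beta> (d # ds) \<in> nb_interior \<beta> \<and> nb_admissible \<beta> ds"

lemma nb_value_interval:
  "\<beta> > 1 \<Longrightarrow> nb_admissible \<beta> ds \<Longrightarrow> nb_value \<beta> ds \<in> nb_interior \<beta>"
  by (cases ds) simp_all

lemma nb_transform_iterate_value:
  assumes "\<beta> > 1" "nb_admissible \<beta> ds"
  shows "(nb_transform \<beta> ^^ length ds) (nb_value \<beta> ds) = 0"
  using assms(2)
proof (induction ds)
  case (Cons d ds)
  have "nb_transform \<beta> (nb_value \<beta> (d # ds)) = nb_value \<beta> ds"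
    using assms(1) nb_interior_subset[OF nb_value_interval[OF assms(1)], of ds] Cons.prems
    by (intro nb_transform_eqI[where d = d]) auto
  then show ?case
    using Cons by (simp add: funpow_swap1 del: nb_value.simps)
qed simp

lemma nb_word_in_nb_Fin:
  assumes "\<beta> > 1" "nb_admissible \<beta> ds"
  shows "nb_value \<beta> ds * (- \<beta>) ^ j \<in> nb_Fin \<beta>"
  using assms nb_integers_iff(2) nb_value_interval nb_transform_iterate_value by blast

lemma nb_word_in_nb_integers:
  assumes "\<beta> > 1" "nb_admissible \<beta> ds"
  shows "nb_value \<beta> ds * (- \<beta>) ^ length ds \<in> nb_integers \<beta>"
  using assms nb_integers_iff(1) nb_value_interval nb_transform_iterate_value by blast

section \<open>The quadratic unit and its conjugate\<close>

locale quadratic_unit =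
  fixes m :: int and \<beta> :: real
  assumes m_ge: "m \<ge> 3" and beta_gt_1: "\<beta> > 1" and beta_square: "\<beta>\<^sup>2 = of_int m * \<beta> - 1"
begin

text \<open>The second root of x^2 = m x - 1, obtained from the sum \<open>m\<close> of the two
  roots.\<close>

definition \<gamma> :: real
  where "\<gamma> = of_int m - \<beta>"

lemma beta_mult_gamma: "\<beta> * \<gamma> = 1"
  using beta_square by (simp add: \<gamma>_def algebra_simps power2_eq_square)

lemma beta_eq: "\<beta> = of_int m - \<gamma>"
  by (simp add: \<gamma>_def)

lemma gamma_square: "\<gamma> * \<gamma> = of_int m * \<gamma> - 1"
  using beta_mult_gamma \<gamma>_def by algebra

lemma m_ge_real: "(of_int m :: real) \<ge> 3"
  using m_ge by simp

lemma gamma_pos: "\<gamma> > 0"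
  using beta_mult_gamma beta_gt_1 by (metis less_trans zero_less_mult_pos zero_less_one)

lemma gamma_less_1: "\<gamma> < 1"
  using beta_mult_gamma beta_gt_1 gamma_pos
  by (metis mult_less_cancel_right_pos mult_1)

text \<open>The extreme case is m = 3, where \<open>\<gamma>\<close> is (3 - sqrt 5) / 2 =
  0.38196...; 191/500 lies just above. Between 191/500 and 1 the chord bounds the square from above,
  against \<open>\<gamma> * \<gamma> \<ge> 3 * \<gamma> - 1\<close>.\<close>

lemma gamma_less: "\<gamma> < 191/500"
proof (rule ccontr)
  assume "\<not> \<gamma> < 191/500"
  then have "(\<gamma> - 191/500) * (1 - \<gamma>) \<ge> 0"
    using gamma_less_1 by simp
  then have "\<gamma> * \<gamma> \<le> 691/500 * \<gamma> - 191/500"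
    by (simp add: field_simps)
  moreover have "\<gamma> * \<gamma> \<ge> 3 * \<gamma> - 1"
    using gamma_square gamma_pos m_ge_real by simp
  ultimately show False
    using \<open>\<not> \<gamma> < 191/500\<close> by linarith
qed

lemma inverse_beta: "1 / \<beta> = \<gamma>" "x / (- \<beta>) = - \<gamma> * x"
  using beta_mult_gamma beta_gt_1 by (simp_all add: field_simps)

lemma interval_bounds: "- \<beta> / (\<beta> + 1) = - 1 / (1 + \<gamma>)" "1 / (\<beta> + 1) = \<gamma> / (1 + \<gamma>)"
  using beta_mult_gamma beta_gt_1 gamma_pos by (simp_all add: field_simps)

text \<open>If \<open>\<beta>\<close> were rational with least denominator \<open>n\<close>, then \<open>n\<gamma>\<close>
  would be a smaller denominator.\<close>

lemma beta_irrational: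
  assumes "of_nat n * \<beta> = of_int a"
  shows "n = 0"
  using assms
proof (induction n arbitrary: a rule: less_induct)
  case (less n)
  show ?case
  proof (rule ccontr)
    assume "n \<noteq> 0"
    define k where "k = int n * m - a"
    have k: "of_int k = of_nat n * \<gamma>"
      using less.prems by (simp add: k_def \<gamma>_def algebra_simps)
    moreover have "of_nat n * \<gamma> > 0" "of_nat n * \<gamma> < of_nat n"
      using \<open>n \<noteq> 0\<close> gamma_pos gamma_less_1 by simp_all
    ultimately have "k > 0" "k < int n"
      by linarith+
    moreover have "of_nat (nat k) * \<beta> = of_int (int n)"
      using k \<open>k > 0\<close> beta_mult_gamma by (simp add: mult_ac)
    ultimately show False
      using less.IH[of "nat k" "int n"] by (simp add: nat_less_iff)
  qed
qed

text \<open>The graph of the automorphism \<open>\<beta> \<mapsto> \<gamma>\<close> of the ring generated by \<open>\<beta>\<close>.\<close>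

definition conjugates :: "real \<Rightarrow> real \<Rightarrow> bool"
  where "conjugates x c \<longleftrightarrow>
    (\<exists>a b :: int. x = of_int a + of_int b * \<beta> \<and> c = of_int a + of_int b * \<gamma>)"

text \<open>Since \<open>\<beta>\<close> is irrational, the coefficients \<open>a\<close> and
  \<open>b\<close> are determined by \<open>x\<close>.\<close>

lemma conjugates_unique:
  assumes "conjugates x c" "conjugates x c'"
  shows "c = c'"
proof -
  obtain a b where 1: "x = of_int a + of_int b * \<beta>" "c = of_int a + of_int b * \<gamma>"
    using assms(1) unfolding conjugates_def by blast
  obtain a' b' where 2: "x = of_int a' + of_int b' * \<beta>" "c' = of_int a' + of_int b' * \<gamma>"
    using assms(2) unfolding conjugates_def by blast
  have *: "of_int (b - b') * \<beta> = of_int (a' - a)"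
    using 1 2 by (simp add: algebra_simps)
  have "b = b'"
  proof (cases "b \<ge> b'")
    case True
    then show ?thesis
      using beta_irrational[of "nat (b - b')" "a' - a"] * by simp
  next
    case False
    then show ?thesis
      using beta_irrational[of "nat (b' - b)" "a - a'"] * by (simp add: algebra_simps)
  qed
  then show ?thesis
    using 1 2 by simp
qed

section \<open>Compatibility of conjugation with the ring operations\<close>

lemma conjugates_of_int: "conjugates (of_int a) (of_int a)"
  unfolding conjugates_def by (intro exI[of _ a] exI[of _ 0]) simp

lemma conjugates_beta: "conjugates \<beta> \<gamma>"
  unfolding conjugates_def by (intro exI[of _ 0] exI[of _ 1]) simp

lemma conjugates_add:
  assumes "conjugates x c" "conjugates y d"
  shows "conjugates (x + y) (c + d)"
proof -
  obtain a b where "x = of_int a + of_int b * \<beta>" "c = of_int a + of_int b * \<gamma>"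
    using assms(1) unfolding conjugates_def by blast
  moreover obtain a' b' where "y = of_int a' + of_int b' * \<beta>" "d = of_int a' + of_int b' * \<gamma>"
    using assms(2) unfolding conjugates_def by blast
  ultimately show ?thesis
    unfolding conjugates_def
    by (intro exI[of _ "a + a'"] exI[of _ "b + b'"]) (simp add: algebra_simps)
qed

lemma conjugates_mult:
  assumes "conjugates x c" "conjugates y d"
  shows "conjugates (x * y) (c * d)"
proof -
  obtain a b where 1: "x = of_int a + of_int b * \<beta>" "c = of_int a + of_int b * \<gamma>"
    using assms(1) unfolding conjugates_def by blast
  obtain a' b' where 2: "y = of_int a' + of_int b' * \<beta>" "d = of_int a' + of_int b' * \<gamma>"
    using assms(2) unfolding conjugates_def by blast
  have "x * y = of_int (a * a') + of_int (a * b' + a' * b) * \<beta> + of_int (b * b') * \<beta>\<^sup>2"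
    by (simp add: 1 2 algebra_simps power2_eq_square)
  moreover have "c * d = of_int (a * a') + of_int (a * b' + a' * b) * \<gamma> + of_int (b * b') * (\<gamma> * \<gamma>)"
    by (simp add: 1 2 algebra_simps)
  ultimately show ?thesis
    unfolding conjugates_def beta_square gamma_square
    by (intro exI[of _ "a * a' - b * b'"] exI[of _ "a * b' + a' * b + b * b' * m"])
      (simp add: algebra_simps)
qed

lemma conjugates_uminus: "conjugates x c \<Longrightarrow> conjugates (- x) (- c)"
  using conjugates_mult[OF conjugates_of_int[of "-1"]] by simp

lemma conjugates_power: "conjugates x c \<Longrightarrow> conjugates (x ^ k) (c ^ k)"
  using conjugates_of_int[of 1] by (induction k) (simp_all add: conjugates_mult)

section \<open>Bounds for the conjugates of integers\<close>

text \<open>The supremum of the conjugates of \<open>(-\<beta>)\<close>-integers, attained in the limit by the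
  digit strings \<open>(m-2) 0 (m-2) 0 \<dots> 0 (m-2)\<close>: it is \<open>(m - 2) / (1 - \<gamma>\<^sup>2)\<close>.\<close>

definition conj_sup :: real
  where "conj_sup = (1 - \<gamma>) / (\<gamma> * (1 + \<gamma>))"

lemma conj_sup_pos: "conj_sup > 0"
  using gamma_pos gamma_less_1 by (simp add: conj_sup_def)

text \<open>The lower extreme: appending the digit 1 to a prefix with conjugate
  \<open>conj_sup + 1\<close> gives exactly \<open>\<gamma>\<^sup>2 * conj_sup\<close>.\<close>

lemma conj_sup_eq1: "\<gamma> * (conj_sup + 1) = 1 - \<gamma>\<^sup>2 * conj_sup"
proof -
  have "conj_sup * (\<gamma> * (1 + \<gamma>)) = 1 - \<gamma>"
    using gamma_pos by (simp add: conj_sup_def)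
  then show ?thesis
    by (simp add: algebra_simps power2_eq_square)
qed

text \<open>Appending the digits 0 and m - 2 sends a conjugate \<open>c\<close> to
  \<open>m - 2 + \<gamma>\<^sup>2 * c\<close>; \<open>conj_sup\<close> is the fixed point.\<close>

lemma conj_sup_eq2: "conj_sup = of_int m - 2 + \<gamma>\<^sup>2 * conj_sup"
proof -
  have "\<gamma> * (conj_sup - \<gamma>\<^sup>2 * conj_sup) = (1 - \<gamma>) * (\<gamma> * (conj_sup + 1) + \<gamma>\<^sup>2 * conj_sup - \<gamma>)"
    by (simp add: algebra_simps power2_eq_square)
  also have "\<gamma> * (conj_sup + 1) + \<gamma>\<^sup>2 * conj_sup - \<gamma> = 1 - \<gamma>"
    using conj_sup_eq1 by simp
  also have "(1 - \<gamma>) * (1 - \<gamma>) = \<gamma> * (of_int m - 2)"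
    using gamma_square by (simp add: algebra_simps)
  finally show ?thesis
    using gamma_pos by simp
qed

text \<open>\<open>t\<close> is the remainder of an expansion and \<open>c\<close> the conjugate of the integer formed by the
  digits already produced. The last digit can be \<open>m - 1\<close> only if the next digit is positive,
  that is if \<open>t \<le> -1 / (\<beta> * (\<beta> + 1))\<close>.\<close>

definition conj_invariant :: "real \<Rightarrow> real \<Rightarrow> bool"
  where "conj_invariant t c \<longleftrightarrow>
    - \<gamma> * conj_sup \<le> c \<and> c \<le> conj_sup + 1 \<and> (t > - 1 / (\<beta> * (\<beta> + 1)) \<longrightarrow> c \<le> conj_sup)"

text \<open>Appending the digit \<open>d\<close> turns \<open>c\<close> into
  \<open>d - \<gamma> * c\<close>. If d = 0, then \<open>t\<close> is above the threshold, so
  \<open>c \<le> conj_sup\<close> gives the lower bound; if d > 0, \<open>conj_sup_eq1\<close> does.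
  By \<open>conj_sup_eq2\<close> the upper bound is \<open>conj_sup\<close> for d at most m - 2, and
  larger by 1 for d = m - 1.\<close>

lemma conj_invariant_step:
  assumes t: "t \<in> nb_interval \<beta>" and inv: "conj_invariant t c"
    and d: "d = \<lfloor>- \<beta> * t + \<beta> / (\<beta> + 1)\<rfloor>"
  shows "conj_invariant (nb_transform \<beta> t) (of_int d - \<gamma> * c)"
    and "d \<ge> 0"
    and "d > 0 \<Longrightarrow> of_int d - \<gamma> * c \<ge> \<gamma>\<^sup>2 * conj_sup"
proof -
  have "\<beta> * t < \<beta> * (1 / (\<beta> + 1))"
    using t beta_gt_1 by (intro mult_strict_left_mono) (auto simp: nb_interval_def)
  then have lo: "- \<beta> * t + \<beta> / (\<beta> + 1) > 0"
    by simp
  have "\<beta> * t \<ge> \<beta> * (- \<beta> / (\<beta> + 1))"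
    using t beta_gt_1 by (intro mult_left_mono) (auto simp: nb_interval_def)
  moreover have "\<beta> * (- \<beta> / (\<beta> + 1)) = \<beta> / (\<beta> + 1) - \<beta>"
    using beta_gt_1 by (simp add: field_simps)
  ultimately have hi: "- \<beta> * t + \<beta> / (\<beta> + 1) \<le> \<beta>"
    by simp
  show "d \<ge> 0"
    using lo unfolding d by simp
  have "d < m"
    using hi gamma_pos beta_eq unfolding d floor_less_iff by linarith
  have sq: "\<gamma>\<^sup>2 * conj_sup > 0" "\<gamma> * conj_sup > 0"
    using gamma_pos conj_sup_pos by simp_all
  have c_hi: "\<gamma> * c \<le> \<gamma> * (conj_sup + 1)"
    using inv gamma_pos unfolding conj_invariant_def by simp
  have "\<gamma> * c \<ge> \<gamma> * (- \<gamma> * conj_sup)"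
    using inv gamma_pos unfolding conj_invariant_def by (intro mult_left_mono) auto
  then have c_lo: "\<gamma> * c \<ge> - (\<gamma>\<^sup>2 * conj_sup)"
    by (simp add: power2_eq_square)
  show pos: "of_int d - \<gamma> * c \<ge> \<gamma>\<^sup>2 * conj_sup" if "d > 0"
    using c_hi that conj_sup_eq1 by linarith
  have "of_int d - \<gamma> * c \<ge> - \<gamma> * conj_sup"
  proof (cases "d = 0")
    case True
    then have "- \<beta> * t + \<beta> / (\<beta> + 1) < 1"
      unfolding d by linarith
    moreover have "1 / (\<beta> + 1) = 1 - \<beta> / (\<beta> + 1)"
      using beta_gt_1 by (simp add: field_simps)
    ultimately have "\<beta> * t > \<beta> * (- 1 / (\<beta> * (\<beta> + 1)))"
      using beta_gt_1 by simp
    then have "t > - 1 / (\<beta> * (\<beta> + 1))"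
      using beta_gt_1 by (subst (asm) mult_less_cancel_left_pos) auto
    then have "c \<le> conj_sup"
      using inv unfolding conj_invariant_def by blast
    then have "\<gamma> * c \<le> \<gamma> * conj_sup"
      using gamma_pos by simp
    then show ?thesis
      using True by simp
  next
    case False
    then show ?thesis
      using pos \<open>d \<ge> 0\<close> sq by linarith
  qed
  moreover have c_upper: "of_int d - \<gamma> * c \<le> of_int d + conj_sup - (of_int m - 2)"
    using c_lo conj_sup_eq2 by linarith
  moreover have "of_int d \<le> (of_int m - 1 :: real)"
    using \<open>d < m\<close> by linarith
  moreover have "of_int d - \<gamma> * c \<le> conj_sup" if "nb_transform \<beta> t > - 1 / (\<beta> * (\<beta> + 1))"
  proof -
    \<comment> \<open>The threshold is the largest remainder that the digit m - 1 can leave, so a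
      remainder above it forces \<open>d < m - 1\<close>.\<close>
    have "- 1 / (\<beta> * (\<beta> + 1)) = 1 / (\<beta> + 1) - 1 / \<beta>"
      using beta_gt_1 by (simp add: field_simps)
    also have "\<dots> = \<beta> - \<beta> / (\<beta> + 1) - (of_int m - 1)"
      using beta_gt_1 by (simp add: inverse_beta \<gamma>_def field_simps)
    finally have "nb_transform \<beta> t > \<beta> - \<beta> / (\<beta> + 1) - (of_int m - 1)"
      using that by simp
    moreover have "nb_transform \<beta> t = - \<beta> * t - of_int d"
      by (simp add: nb_transform_def d)
    ultimately have "d < m - 1"
      using hi by linarith
    then have "of_int d \<le> (of_int m - 2 :: real)"
      by linarith
    then show ?thesis
      using c_upper by linarith
  qed
  ultimately show "conj_invariant (nb_transform \<beta> t) (of_int d - \<gamma> * c)"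
    unfolding conj_invariant_def by (intro conjI impI) linarith+
qed

text \<open>Here \<open>u\<close> is the integer formed by the first \<open>n\<close> digits of
  \<open>y\<close>, starting from 0.\<close>

lemma conj_invariant_iterate:
  assumes "y \<in> nb_interval \<beta>"
  shows "\<exists>u c. (nb_transform \<beta> ^^ n) y = (- \<beta>) ^ n * y - u \<and> conjugates u c
    \<and> conj_invariant ((nb_transform \<beta> ^^ n) y) c"
proof (induction n)
  case 0
  have "conj_invariant y 0"
    using conj_sup_pos gamma_pos by (simp add: conj_invariant_def)
  then show ?case
    using conjugates_of_int[of 0] by (intro exI[of _ 0]) simp
next
  case (Suc n)
  let ?t = "(nb_transform \<beta> ^^ n) y"
  define d where "d = \<lfloor>- \<beta> * ?t + \<beta> / (\<beta> + 1)\<rfloor>"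
  obtain u c where u: "?t = (- \<beta>) ^ n * y - u" "conjugates u c" "conj_invariant ?t c"
    using Suc by blast
  have "(nb_transform \<beta> ^^ Suc n) y = - \<beta> * ?t - of_int d"
    by (simp add: nb_transform_def d_def)
  also have "\<dots> = (- \<beta>) ^ Suc n * y - (of_int d + - (\<beta> * u))"
    unfolding u(1) by (simp add: algebra_simps)
  finally have "(nb_transform \<beta> ^^ Suc n) y = (- \<beta>) ^ Suc n * y - (of_int d + - (\<beta> * u))" .
  moreover have "conjugates (of_int d + - (\<beta> * u)) (of_int d + - (\<gamma> * c))"
    by (intro conjugates_add conjugates_uminus conjugates_mult conjugates_of_int
        conjugates_beta u(2))
  moreover have "conj_invariant ((nb_transform \<beta> ^^ Suc n) y) (of_int d + - (\<gamma> * c))"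
    using conj_invariant_step(1)[OF nb_transform_iterate_in_interval[OF beta_gt_1 assms] u(3) d_def]
    by simp
  ultimately show ?case
    by blast
qed

text \<open>The final remainder 0 is above the threshold, so the invariant gives the sharper upper
  bound.\<close>

lemma conjugates_nb_integer:
  assumes "w \<in> nb_integers \<beta>"
  obtains c where "conjugates w c" "- \<gamma> * conj_sup \<le> c" "c \<le> conj_sup"
proof -
  obtain y j where w: "w = y * (- \<beta>) ^ j" and y: "y \<in> nb_interior \<beta>"
    using nb_shift_decompose[OF beta_gt_1] .
  have "(nb_transform \<beta> ^^ j) y = 0"
    using assms w nb_integers_iff(1)[OF beta_gt_1 y] by simp
  moreover obtain u c where u: "(nb_transform \<beta> ^^ j) y = (- \<beta>) ^ j * y - u" "conjugates u c"
      "conj_invariant ((nb_transform \<beta> ^^ j) y) c"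
    using conj_invariant_iterate[OF nb_interior_subset[OF y]] by blast
  ultimately have "conjugates w c" "conj_invariant 0 c"
    by (simp_all add: w mult.commute)
  moreover have "0 > - 1 / (\<beta> * (\<beta> + 1))"
    using beta_gt_1 by simp
  ultimately show thesis
    using that unfolding conj_invariant_def by blast
qed

lemma conjugates_nb_integer_abs:
  assumes "w \<in> nb_integers \<beta>"
  obtains c where "conjugates w c" "\<bar>c\<bar> \<le> conj_sup"
proof -
  obtain c where c: "conjugates w c" "- \<gamma> * conj_sup \<le> c" "c \<le> conj_sup"
    using conjugates_nb_integer[OF assms] .
  moreover have "\<gamma> * conj_sup \<le> conj_sup"
    using gamma_less_1 conj_sup_pos by simp
  ultimately show thesis
    using that by force
qed

lemma nb_integer_last_digit:
  assumes "w \<in> nb_integers \<beta>"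
  shows "w / (- \<beta>) \<in> nb_integers \<beta> \<or> (\<exists>c. conjugates w c \<and> c \<ge> \<gamma>\<^sup>2 * conj_sup)"
proof -
  obtain y j where w: "w = y * (- \<beta>) ^ j" and y: "y \<in> nb_interior \<beta>"
    using nb_shift_decompose[OF beta_gt_1] .
  have iter: "(nb_transform \<beta> ^^ j) y = 0"
    using assms w nb_integers_iff(1)[OF beta_gt_1 y] by simp
  show ?thesis
  proof (cases j)
    case 0
    then show ?thesis
      using iter w zero_in_nb_integers[OF beta_gt_1] by simp
  next
    case (Suc n)
    let ?t = "(nb_transform \<beta> ^^ n) y"
    define d where "d = \<lfloor>- \<beta> * ?t + \<beta> / (\<beta> + 1)\<rfloor>"
    obtain u c where u: "?t = (- \<beta>) ^ n * y - u" "conjugates u c" "conj_invariant ?t c"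
      using conj_invariant_iterate[OF nb_interior_subset[OF y]] by blast
    have "nb_transform \<beta> ?t = 0"
      using iter Suc by simp
    then have d: "- \<beta> * ?t = of_int d"
      unfolding nb_transform_def d_def[symmetric] by simp
    note step = conj_invariant_step[OF nb_transform_iterate_in_interval[OF beta_gt_1
        nb_interior_subset[OF y]] u(3) d_def]
    show ?thesis
    proof (cases "d = 0")
      case True
      then have "?t = 0"
        using d beta_gt_1 by simp
      then have "y * (- \<beta>) ^ n \<in> nb_integers \<beta>"
        using nb_integers_iff(1)[OF beta_gt_1 y] by blast
      moreover have "w / (- \<beta>) = y * (- \<beta>) ^ n"
        using beta_gt_1 by (simp add: w Suc)
      ultimately show ?thesis
        by simp
    next
      case False
      then have "of_int d + - (\<gamma> * c) \<ge> \<gamma>\<^sup>2 * conj_sup"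
        using step(2,3) by simp
      moreover have "w = - \<beta> * (?t + u)"
        unfolding u(1) by (simp add: w Suc)
      then have "w = of_int d + - (\<beta> * u)"
        using d by (simp add: algebra_simps)
      then have "conjugates w (of_int d + - (\<gamma> * c))"
        by (simp only:) (intro conjugates_add conjugates_uminus conjugates_mult conjugates_of_int
            conjugates_beta u(2))
      ultimately show ?thesis
        by blast
    qed
  qed
qed

text \<open>Let \<open>k\<close> be the number of fractional digits. By minimality
  \<open>(- \<beta>) ^ k * z\<close> has no droppable last digit, so its conjugate is at least
  \<open>\<gamma>\<^sup>2 * conj_sup\<close>; for k at least 3 its modulus is at most
  \<open>\<gamma> ^ 3 * \<bar>c\<bar>\<close>, which is smaller.\<close>

lemma nb_Fin_two_fractional_digits:
  assumes "z \<in> nb_Fin \<beta>" "conjugates z c" "\<gamma> * \<bar>c\<bar> < conj_sup"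
  shows "z \<in> nb_scaled_integers \<beta> 2"
proof -
  define k where "k = (LEAST k. (- \<beta>) ^ k * z \<in> nb_integers \<beta>)"
  obtain k' where "(- \<beta>) ^ k' * z \<in> nb_integers \<beta>"
    using nb_Fin_obtain_scale[OF beta_gt_1 assms(1)] .
  then have k: "(- \<beta>) ^ k * z \<in> nb_integers \<beta>"
    unfolding k_def by (rule LeastI)
  have "k \<le> 2"
  proof (rule ccontr)
    assume "\<not> k \<le> 2"
    then obtain n where n: "k = n + 3"
      by (metis add.commute le_Suc_ex not_less_eq_eq numeral_2_eq_2 numeral_3_eq_3)
    have "(- \<beta>) ^ k * z / (- \<beta>) = (- \<beta>) ^ (n + 2) * z"
      using beta_gt_1 by (simp add: n power_add power2_eq_square power3_eq_cube)
    moreover have "(- \<beta>) ^ (n + 2) * z \<notin> nb_integers \<beta>"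
      using not_less_Least[of "n + 2" "\<lambda>k. (- \<beta>) ^ k * z \<in> nb_integers \<beta>"]
      unfolding k_def[symmetric] n by simp
    ultimately obtain c' where c': "conjugates ((- \<beta>) ^ k * z) c'" "c' \<ge> \<gamma>\<^sup>2 * conj_sup"
      using nb_integer_last_digit[OF k] by metis
    have "conjugates ((- \<beta>) ^ k * z) ((- \<gamma>) ^ k * c)"
      by (intro conjugates_mult conjugates_power conjugates_uminus conjugates_beta assms(2))
    then have "\<gamma>\<^sup>2 * conj_sup \<le> (- \<gamma>) ^ k * c"
      using c' conjugates_unique by blast
    also have "\<dots> \<le> \<gamma> ^ k * \<bar>c\<bar>"
      using gamma_pos by (metis abs_ge_self abs_minus_cancel abs_mult abs_of_pos power_abs)
    also have "\<dots> \<le> \<gamma> ^ 3 * \<bar>c\<bar>"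
      using gamma_pos gamma_less_1 unfolding n
      by (intro mult_right_mono power_decreasing) auto
    also have "\<dots> = \<gamma>\<^sup>2 * (\<gamma> * \<bar>c\<bar>)"
      by (simp add: power2_eq_square power3_eq_cube)
    also have "\<dots> < \<gamma>\<^sup>2 * conj_sup"
      using assms(3) gamma_pos by simp
    finally show False
      by simp
  qed
  then have "(- \<beta>) ^ (2 - k) * ((- \<beta>) ^ k * z) \<in> nb_integers \<beta>"
    using nb_integers_mult_power[OF beta_gt_1 k] by blast
  moreover have "(- \<beta>) ^ (2 - k) * ((- \<beta>) ^ k * z) = (- \<beta>) ^ 2 * z"
    using \<open>k \<le> 2\<close> by (simp add: mult.assoc[symmetric] power_add[symmetric])
  ultimately show ?thesis
    unfolding nb_scaled_integers_iff[OF beta_gt_1] by simp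
qed

text \<open>If l were at most 1, \<open>- \<beta> * z\<close> would be an integer. Its conjugate
  \<open>- \<gamma> * c\<close> would then violate the lower bound
  \<open>- \<gamma> * conj_sup\<close>.\<close>

lemma nb_scaled_integers_ge_2:
  assumes "conjugates z c" "c > conj_sup" "z \<in> nb_scaled_integers \<beta> l"
  shows "l \<ge> 2"
proof (rule ccontr)
  assume "\<not> l \<ge> 2"
  then have l: "(1 - l) + l = 1"
    by simp
  have "(- \<beta>) ^ l * z \<in> nb_integers \<beta>"
    using assms(3) nb_scaled_integers_iff[OF beta_gt_1] by blast
  then have "(- \<beta>) ^ (1 - l) * ((- \<beta>) ^ l * z) \<in> nb_integers \<beta>"
    by (rule nb_integers_mult_power[OF beta_gt_1])
  also have "(- \<beta>) ^ (1 - l) * ((- \<beta>) ^ l * z) = - \<beta> * z"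
    unfolding mult.assoc[symmetric] power_add[symmetric] l by simp
  finally obtain c' where c': "conjugates (- \<beta> * z) c'" "- \<gamma> * conj_sup \<le> c'"
    using conjugates_nb_integer by blast
  have "conjugates (- \<beta> * z) (- \<gamma> * c)"
    by (intro conjugates_mult conjugates_uminus conjugates_beta assms(1))
  then have "- \<gamma> * conj_sup \<le> - \<gamma> * c"
    using c' conjugates_unique by blast
  then show False
    using assms(2) gamma_pos by simp
qed

section \<open>Witnesses\<close>

definition nb_word :: "int list \<Rightarrow> real \<Rightarrow> bool"
  where "nb_word ds v \<longleftrightarrow> nb_admissible \<beta> ds \<and> nb_value \<beta> ds = v"

lemma nb_word_Nil: "nb_word [] 0"
  by (simp add: nb_word_def)

text \<open>Strings are built from the last digit to the first. With \<open>s\<close> the negated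
  value, the factor \<open>1 + \<gamma>\<close> clears the denominators of the interval
  bounds.\<close>

lemma nb_word_Cons:
  assumes "nb_word ds v" "s = \<gamma> * (of_int d + v)" "- \<gamma> < s * (1 + \<gamma>)" "s * (1 + \<gamma>) < 1"
  shows "nb_word (d # ds) (- s)"
proof -
  have "- s \<in> nb_interior \<beta>"
    using assms(3,4) gamma_pos unfolding interval_bounds
    by (auto simp: pos_less_divide_eq pos_divide_less_eq)
  moreover have "nb_value \<beta> (d # ds) = - s"
    using assms(1,2) inverse_beta(2)[of "of_int d + v"] by (simp add: nb_word_def)
  ultimately show ?thesis
    using assms(1) by (simp add: nb_word_def del: nb_value.simps)
qed

lemma nb_word_in_nb_integersI:
  assumes "nb_word ds v" "x = v * (- \<beta>) ^ length ds"
  shows "x \<in> nb_integers \<beta>"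
  using assms nb_word_in_nb_integers[OF beta_gt_1] unfolding nb_word_def by metis

lemma nb_word_in_nb_FinI:
  assumes "nb_word ds v" "x = v * (- \<beta>) ^ j"
  shows "x \<in> nb_Fin \<beta>"
  using assms nb_word_in_nb_Fin[OF beta_gt_1] unfolding nb_word_def by metis

lemma digit_in_nb_integers:
  assumes "0 \<le> d" "d \<le> m - 2"
  shows "of_int d \<in> nb_integers \<beta>"
proof -
  have d: "of_int d \<le> (of_int m - 2 :: real)"
    using assms(2) by linarith
  have "\<gamma> * of_int d * (1 + \<gamma>) \<le> \<gamma> * (of_int m - 2) * (1 + \<gamma>)"
    using gamma_pos d by (intro mult_right_mono mult_left_mono) auto
  \<comment> \<open>The quadratic equation makes the largest case a perfect square.\<close>
  also have "\<gamma> * (of_int m - 2) = (1 - \<gamma>) * (1 - \<gamma>)"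
    using gamma_square by (simp add: algebra_simps)
  also have "(1 - \<gamma>) * (1 - \<gamma>) * (1 + \<gamma>) = (1 - \<gamma>) * (1 - \<gamma>\<^sup>2)"
    by (simp add: algebra_simps power2_eq_square)
  also have "\<dots> < 1 * 1"
    using gamma_pos gamma_less_1 by (intro mult_strict_mono) (auto simp: power_le_one)
  finally have "\<gamma> * of_int d * (1 + \<gamma>) < 1"
    by simp
  moreover have "0 \<le> \<gamma> * of_int d * (1 + \<gamma>)"
    using assms(1) gamma_pos by simp
  ultimately have "nb_word [d] (- (\<gamma> * of_int d))"
    using gamma_pos by (intro nb_word_Cons[OF nb_word_Nil]) auto
  then show ?thesis
    by (rule nb_word_in_nb_integersI) (use beta_mult_gamma in \<open>simp add: mult_ac\<close>)
qed

lemma gamma_square_less: "\<gamma>\<^sup>2 < 1 / 4"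
proof -
  have "\<gamma> * \<gamma> < (1 / 2) * (1 / 2)"
    using gamma_pos gamma_less by (intro mult_strict_mono) auto
  then show ?thesis
    by (simp add: power2_eq_square)
qed

text \<open>The expansion of \<open>2(m-2)\<close> has integer part \<open>1 (m-1) (m-2)\<close> and fractional part
  \<open>(m-1) 1\<close>.\<close>

lemma double_digit_in_nb_Fin: "2 * (of_int m - 2) \<in> nb_Fin \<beta>"
proof -
  have sq: "\<gamma> * \<gamma> < 191 / 500 * \<gamma>"
    using gamma_less gamma_pos by (intro mult_strict_right_mono) auto
  have pos: "\<gamma>\<^sup>2 > 0"
    using gamma_pos by simp
  have "\<gamma> * (1 + \<gamma>) < 1"
    using sq gamma_less unfolding distrib_left by linarith
  moreover have "\<gamma> * (1 + \<gamma>) > 0"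
    using gamma_pos by simp
  then have "- \<gamma> < \<gamma> * (1 + \<gamma>)"
    using gamma_pos by linarith
  ultimately have "nb_word [1] (- \<gamma>)"
    by (intro nb_word_Cons[OF nb_word_Nil]) simp_all
  then have "nb_word [m - 1, 1] (- (1 - \<gamma>))"
  proof (rule nb_word_Cons)
    show "1 - \<gamma> = \<gamma> * (of_int (m - 1) + - \<gamma>)"
      using gamma_square by (simp add: algebra_simps)
    have "(1 - \<gamma>) * (1 + \<gamma>) = 1 - \<gamma>\<^sup>2"
      by (simp add: algebra_simps power2_eq_square)
    then show "- \<gamma> < (1 - \<gamma>) * (1 + \<gamma>)" "(1 - \<gamma>) * (1 + \<gamma>) < 1"
      using pos gamma_pos gamma_square_less by linarith+
  qed
  then have "nb_word [m - 2, m - 1, 1] (- ((1 - \<gamma>) * (1 - 2 * \<gamma>)))"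
  proof (rule nb_word_Cons)
    show "(1 - \<gamma>) * (1 - 2 * \<gamma>) = \<gamma> * (of_int (m - 2) + - (1 - \<gamma>))"
      using gamma_square by (simp add: algebra_simps)
    have "(1 - \<gamma>) * (1 - 2 * \<gamma>) * (1 + \<gamma>) = (1 - 2 * \<gamma>) * (1 - \<gamma>\<^sup>2)"
      by (simp add: algebra_simps power2_eq_square)
    moreover have "(1 - 2 * \<gamma>) * (1 - \<gamma>\<^sup>2) > 0"
      using gamma_less gamma_square_less by simp
    moreover have "(1 - 2 * \<gamma>) * (1 - \<gamma>\<^sup>2) < 1 * 1"
      using gamma_less gamma_pos pos gamma_square_less by (intro mult_strict_mono) auto
    ultimately show "- \<gamma> < (1 - \<gamma>) * (1 - 2 * \<gamma>) * (1 + \<gamma>)"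
      "(1 - \<gamma>) * (1 - 2 * \<gamma>) * (1 + \<gamma>) < 1"
      using gamma_pos by linarith+
  qed
  then have "nb_word [m - 1, m - 2, m - 1, 1] (- (1 - 2 * \<gamma> + 4 * \<gamma>\<^sup>2 - 2 * \<gamma> ^ 3))"
  proof (rule nb_word_Cons)
    let ?s = "1 - 2 * \<gamma> + 4 * \<gamma>\<^sup>2 - 2 * \<gamma> ^ 3"
    have "\<gamma> * (of_int (m - 1) + - ((1 - \<gamma>) * (1 - 2 * \<gamma>)))
        = of_int m * \<gamma> - 2 * \<gamma> + 3 * (\<gamma> * \<gamma>) - 2 * \<gamma> ^ 3"
      by (simp add: algebra_simps power3_eq_cube)
    also have "of_int m * \<gamma> = 1 + \<gamma> * \<gamma>"
      using gamma_square by simp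
    finally show "?s = \<gamma> * (of_int (m - 1) + - ((1 - \<gamma>) * (1 - 2 * \<gamma>)))"
      by (simp add: power2_eq_square)
    have "?s = (1 - 2 * \<gamma>) + 2 * \<gamma>\<^sup>2 * (2 - \<gamma>)"
      by (simp add: algebra_simps power2_eq_square power3_eq_cube)
    also have "\<dots> > 0"
      using gamma_less gamma_less_1 gamma_pos by (intro add_pos_pos) auto
    finally have "?s * (1 + \<gamma>) > 0"
      using gamma_pos by simp
    then show "- \<gamma> < ?s * (1 + \<gamma>)"
      using gamma_pos by linarith
    have "?s * (1 + \<gamma>) = 1 - \<gamma> * (1 - 2 * \<gamma> - 2 * \<gamma> * \<gamma> + 2 * \<gamma> ^ 3)"
      by (simp add: algebra_simps power2_eq_square power3_eq_cube)
    moreover have "1 - 2 * \<gamma> - 2 * \<gamma> * \<gamma> + 2 * \<gamma> ^ 3 > 0"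
    proof -
      \<comment> \<open>With 1/4 as the maximum of \<open>\<gamma> * (1 - \<gamma>)\<close>, the
        cubic stays above 1 - 5/2 * 191/500 = 0.045.\<close>
      have "(\<gamma> - 1 / 2) * (\<gamma> - 1 / 2) \<ge> 0"
        by (rule zero_le_square)
      then have "\<gamma> * (1 - \<gamma>) \<le> 1 / 4"
        by (simp add: field_simps)
      then have "\<gamma> * (\<gamma> * (1 - \<gamma>)) \<le> 191 / 500 * (1 / 4)"
        using gamma_pos gamma_less gamma_less_1 by (intro mult_mono) auto
      moreover have "1 - 2 * \<gamma> - 2 * \<gamma> * \<gamma> + 2 * \<gamma> ^ 3 = 1 - 2 * \<gamma> - 2 * (\<gamma> * (\<gamma> * (1 - \<gamma>)))"
        by (simp add: algebra_simps power3_eq_cube)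
      ultimately show ?thesis
        using gamma_less by simp
    qed
    ultimately show "?s * (1 + \<gamma>) < 1"
      using gamma_pos by simp
  qed
  then have word: "nb_word [1, m - 1, m - 2, m - 1, 1] (- (2 * \<gamma>\<^sup>2 * (1 - \<gamma>)\<^sup>2))"
  proof (rule nb_word_Cons)
    let ?s = "2 * \<gamma>\<^sup>2 * (1 - \<gamma>)\<^sup>2"
    show "?s = \<gamma> * (of_int 1 + - (1 - 2 * \<gamma> + 4 * \<gamma>\<^sup>2 - 2 * \<gamma> ^ 3))"
      by (simp add: algebra_simps power2_eq_square power3_eq_cube)
    have "?s \<ge> 0"
      by simp
    then have "?s * (1 + \<gamma>) \<ge> 0"
      using gamma_pos by simp
    then show "- \<gamma> < ?s * (1 + \<gamma>)"
      using gamma_pos by linarith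
    have "?s * (1 + \<gamma>) = 2 * \<gamma>\<^sup>2 * ((1 - \<gamma>) * (1 - \<gamma>\<^sup>2))"
      by (simp add: algebra_simps power2_eq_square)
    also have "\<dots> \<le> 2 * \<gamma>\<^sup>2 * 1"
      using gamma_pos gamma_less_1 gamma_square_less by (intro mult_left_mono mult_le_one) auto
    finally show "?s * (1 + \<gamma>) < 1"
      using gamma_square_less by linarith
  qed
  \<comment> \<open>The exponent 3 puts three of the five digits before the radix point; what
    remains is 2 (\<beta> - 2 + \<gamma>).\<close>
  have "- (2 * \<gamma>\<^sup>2 * (1 - \<gamma>)\<^sup>2) * (- \<beta>) ^ 3 = 2 * (\<beta> * \<gamma>)\<^sup>2 * (\<beta> - 2 * (\<beta> * \<gamma>) + \<beta> * \<gamma> * \<gamma>)"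
    by (simp add: algebra_simps power2_eq_square power3_eq_cube)
  also have "\<dots> = 2 * (of_int m - 2)"
    unfolding beta_mult_gamma by (simp add: \<gamma>_def)
  finally have "- (2 * \<gamma>\<^sup>2 * (1 - \<gamma>)\<^sup>2) * (- \<beta>) ^ 3 = 2 * (of_int m - 2)" .
  then show ?thesis
    using nb_word_in_nb_FinI[OF word] by metis
qed

text \<open>By \<open>conj_sup_eq2\<close> and \<open>\<gamma>\<^sup>2 < 1 / 4\<close>,
  \<open>conj_sup\<close> is even below 4/3 (m - 2).\<close>

lemma conj_sup_less: "conj_sup < 2 * (of_int m - 2)"
proof -
  define p where "p = \<gamma>\<^sup>2 * conj_sup"
  have "p < 1 / 4 * conj_sup"
    unfolding p_def using gamma_square_less conj_sup_pos by (rule mult_strict_right_mono)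
  then have "4 * p < conj_sup"
    by simp
  moreover have "conj_sup = of_int m - 2 + p"
    unfolding p_def by (rule conj_sup_eq2)
  ultimately show ?thesis
    using conj_sup_pos by argo
qed

text \<open>For \<open>m = 3\<close> the factors of \<open>2(m-2) = 2 \<cdot> (m-2)\<close> are not both integers, so a separate
  witness is needed: \<open>3\<beta> = 1 + \<beta>\<^sup>2\<close> has the expansion \<open>1 0 1\<close>, and \<open>(3\<beta>)\<^sup>2\<close> has
  integer part \<open>2 2 1 1 0\<close> and fractional part \<open>2 1\<close>.\<close>

lemma product_witness_3:
  assumes "m = 3"
  shows "3 * \<beta> \<in> nb_integers \<beta>" and "(3 * \<beta>) * (3 * \<beta>) \<in> nb_Fin \<beta>"
    and "conj_sup < (3 * \<gamma>) * (3 * \<gamma>)"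
proof -
  have sq: "\<gamma> * \<gamma> = 3 * \<gamma> - 1"
    using gamma_square assms by simp
  \<comment> \<open>The tangent to the square at 0.3819, just below (3 - sqrt 5) / 2, yields a
    linear lower bound from \<open>sq\<close>.\<close>
  have "(\<gamma> - 3819 / 10000) * (\<gamma> - 3819 / 10000) \<ge> 0"
    by (rule zero_le_square)
  then have lower: "\<gamma> > 3819 / 10000"
    using sq by (simp add: algebra_simps)
  note upper = gamma_less
  \<comment> \<open>Reducing by \<open>sq\<close> keeps every value in the form
    \<open>p + q * \<gamma>\<close>, so each interval check is linear in \<open>\<gamma>\<close> and
    follows from \<open>lower\<close> and \<open>upper\<close>.\<close>
  have linear_Cons: "nb_word (d # ds) (- (p + q * \<gamma>))"
    if "nb_word ds (- (p' + q' * \<gamma>))" "p = q'" "q = of_int d - p' - 3 * q'"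
      "- \<gamma> < (p - q) + (p + 4 * q) * \<gamma>" "(p - q) + (p + 4 * q) * \<gamma> < 1"
    for d ds p q p' q'
  proof -
    have "\<gamma> * (of_int d + - (p' + q' * \<gamma>)) = (of_int d - p') * \<gamma> - q' * (\<gamma> * \<gamma>)"
      by (simp add: algebra_simps)
    then have "p + q * \<gamma> = \<gamma> * (of_int d + - (p' + q' * \<gamma>))"
      unfolding sq that(2,3) by (simp add: algebra_simps)
    moreover have "(p + q * \<gamma>) * (1 + \<gamma>) = p + (p + q) * \<gamma> + q * (\<gamma> * \<gamma>)"
      by (simp add: algebra_simps)
    then have "(p + q * \<gamma>) * (1 + \<gamma>) = (p - q) + (p + 4 * q) * \<gamma>"
      unfolding sq by (simp add: algebra_simps)
    ultimately show ?thesis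
      using that by (intro nb_word_Cons[OF that(1)]) simp_all
  qed
  have w1: "nb_word [1] (- (0 + 1 * \<gamma>))"
    using lower upper by (intro linear_Cons[of "[]" 0 0]) (simp_all add: nb_word_Nil)
  have "nb_word [0, 1] (- (1 + - 3 * \<gamma>))"
    using lower upper by (intro linear_Cons[OF w1]) simp_all
  then have "nb_word [1, 0, 1] (- (- 3 + 9 * \<gamma>))"
    using lower upper by (elim linear_Cons) simp_all
  then show "3 * \<beta> \<in> nb_integers \<beta>"
  proof (rule nb_word_in_nb_integersI)
    have "- (- 3 + 9 * \<gamma>) * (- \<beta>) ^ 3 = - (3 * (\<gamma> * \<gamma>)) * (- \<beta>) ^ 3"
      unfolding sq by simp
    also have "\<dots> = 3 * \<beta> * (\<beta> * \<gamma>)\<^sup>2"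
      by (simp add: power2_eq_square power3_eq_cube)
    finally show "3 * \<beta> = - (- 3 + 9 * \<gamma>) * (- \<beta>) ^ length [1, 0, 1 :: int]"
      unfolding beta_mult_gamma by (simp add: eval_nat_numeral)
  qed
  have "nb_word [2, 1] (- (1 + - 1 * \<gamma>))"
    using lower upper by (intro linear_Cons[OF w1]) simp_all
  then have "nb_word [0, 2, 1] (- (- 1 + 2 * \<gamma>))"
    using lower upper by (elim linear_Cons) simp_all
  then have "nb_word [1, 0, 2, 1] (- (2 + - 4 * \<gamma>))"
    using lower upper by (elim linear_Cons) simp_all
  then have "nb_word [1, 1, 0, 2, 1] (- (- 4 + 11 * \<gamma>))"
    using lower upper by (elim linear_Cons) simp_all
  then have "nb_word [2, 1, 1, 0, 2, 1] (- (11 + - 27 * \<gamma>))"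
    using lower upper by (elim linear_Cons) simp_all
  then have "nb_word [2, 2, 1, 1, 0, 2, 1] (- (- 27 + 72 * \<gamma>))"
    using lower upper by (elim linear_Cons) simp_all
  then show "(3 * \<beta>) * (3 * \<beta>) \<in> nb_Fin \<beta>"
  proof (rule nb_word_in_nb_FinI)
    have "- 27 + 72 * \<gamma> = 9 * (\<gamma> * (\<gamma> * \<gamma>))"
      using sq by algebra
    then have "- (- 27 + 72 * \<gamma>) * (- \<beta>) ^ 5 = - (9 * (\<gamma> * (\<gamma> * \<gamma>))) * (- \<beta>) ^ 5"
      by simp
    also have "\<dots> = (3 * \<beta>) * (3 * \<beta>) * (\<beta> * \<gamma>) ^ 3"
      by (simp add: eval_nat_numeral)
    finally show "(3 * \<beta>) * (3 * \<beta>) = - (- 27 + 72 * \<gamma>) * (- \<beta>) ^ 5"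
      unfolding beta_mult_gamma by simp
  qed
  show "conj_sup < (3 * \<gamma>) * (3 * \<gamma>)"
  proof -
    define p where "p = \<gamma>\<^sup>2 * conj_sup"
    have "\<gamma>\<^sup>2 \<le> 146 / 1000"
      using upper sq by (simp add: power2_eq_square)
    then have "p \<le> 146 / 1000 * conj_sup"
      unfolding p_def using conj_sup_pos by (intro mult_right_mono) auto
    moreover have "conj_sup = 1 + p"
      using conj_sup_eq2 assms unfolding p_def by simp
    ultimately have "1000 * conj_sup \<le> 1000 + 146 * conj_sup"
      by simp
    moreover have "(3 * \<gamma>) * (3 * \<gamma>) = 9 * (3 * \<gamma> - 1)"
      unfolding sq[symmetric] by simp
    ultimately show ?thesis
      using lower by argo
  qed
qed

section \<open>The two minima\<close>

lemma sum_in_nb_scaled_integers: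
  assumes "x \<in> nb_integers \<beta>" "y \<in> nb_integers \<beta>" "x + y \<in> nb_Fin \<beta>"
  shows "x + y \<in> nb_scaled_integers \<beta> 2"
proof -
  obtain c d where c: "conjugates x c" "\<bar>c\<bar> \<le> conj_sup" and d: "conjugates y d" "\<bar>d\<bar> \<le> conj_sup"
    using assms(1,2) conjugates_nb_integer_abs by metis
  have "\<gamma> * \<bar>c + d\<bar> \<le> \<gamma> * (2 * conj_sup)"
    using c d gamma_pos by (intro mult_left_mono) auto
  also have "\<dots> < conj_sup"
    using gamma_less conj_sup_pos by simp
  finally show ?thesis
    using nb_Fin_two_fractional_digits[OF assms(3) conjugates_add[OF c(1) d(1)]] by blast
qed

lemma product_in_nb_scaled_integers:
  assumes "x \<in> nb_integers \<beta>" "y \<in> nb_integers \<beta>" "x * y \<in> nb_Fin \<beta>"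
  shows "x * y \<in> nb_scaled_integers \<beta> 2"
proof -
  obtain c d where c: "conjugates x c" "\<bar>c\<bar> \<le> conj_sup" and d: "conjugates y d" "\<bar>d\<bar> \<le> conj_sup"
    using assms(1,2) conjugates_nb_integer_abs by metis
  have "\<gamma> * \<bar>c * d\<bar> \<le> \<gamma> * (conj_sup * conj_sup)"
    unfolding abs_mult using c d gamma_pos by (intro mult_left_mono mult_mono) auto
  also have "\<dots> = (\<gamma> * conj_sup) * conj_sup"
    by simp
  also have "\<dots> < 1 * conj_sup"
  proof (intro mult_strict_right_mono conj_sup_pos)
    have "\<gamma>\<^sup>2 * conj_sup > 0"
      using gamma_pos conj_sup_pos by simp
    then show "\<gamma> * conj_sup < 1"
      using conj_sup_eq1 gamma_pos by (simp add: distrib_left)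
  qed
  finally show ?thesis
    using nb_Fin_two_fractional_digits[OF assms(3) conjugates_mult[OF c(1) d(1)]] by simp
qed

lemma sum_witness:
  "\<exists>x \<in> nb_integers \<beta>. \<exists>y \<in> nb_integers \<beta>. x + y \<in> nb_Fin \<beta> \<and>
    (\<exists>c. conjugates (x + y) c \<and> c > conj_sup)"
proof -
  have x: "of_int (m - 2) \<in> nb_integers \<beta>"
    using m_ge by (intro digit_in_nb_integers) auto
  have eq: "of_int (m - 2) + of_int (m - 2) = 2 * (of_int m - 2 :: real)"
    by simp
  have "conjugates (of_int (m - 2) + of_int (m - 2)) (of_int (m - 2) + of_int (m - 2))"
    by (intro conjugates_add conjugates_of_int)
  then show ?thesis
    using x double_digit_in_nb_Fin conj_sup_less unfolding eq[symmetric] by blast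
qed

lemma product_witness:
  "\<exists>x \<in> nb_integers \<beta>. \<exists>y \<in> nb_integers \<beta>. x * y \<in> nb_Fin \<beta> \<and>
    (\<exists>c. conjugates (x * y) c \<and> c > conj_sup)"
proof (cases "m = 3")
  case True
  have "conjugates (of_int 3 * \<beta>) (of_int 3 * \<gamma>)"
    by (intro conjugates_mult conjugates_of_int conjugates_beta)
  then have "conjugates ((3 * \<beta>) * (3 * \<beta>)) ((3 * \<gamma>) * (3 * \<gamma>))"
    using conjugates_mult[of "3 * \<beta>" "3 * \<gamma>" "3 * \<beta>" "3 * \<gamma>"] by simp
  then show ?thesis
    using product_witness_3[OF True] by blast
next
  case False
  have x: "of_int (m - 2) \<in> nb_integers \<beta>" "of_int 2 \<in> nb_integers \<beta>"
    using m_ge False by (intro digit_in_nb_integers; simp)+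
  have eq: "of_int 2 * of_int (m - 2) = 2 * (of_int m - 2 :: real)"
    by simp
  have "conjugates (of_int 2 * of_int (m - 2)) (of_int 2 * of_int (m - 2))"
    by (intro conjugates_mult conjugates_of_int)
  then show ?thesis
    using x double_digit_in_nb_Fin conj_sup_less unfolding eq[symmetric] by blast
qed

end

lemma Inf_enat_image_eq:
  assumes "n \<in> S" "\<And>l. l \<in> S \<Longrightarrow> n \<le> l"
  shows "Inf (enat ` S) = enat n"
  using assms by (intro antisym Inf_lower Inf_greatest) auto

theorem theorem13:
  fixes m :: int and \<beta> :: real
  assumes "m \<ge> 3" and "\<beta> > 1" and "\<beta>\<^sup>2 = of_int m * \<beta> - 1"
  shows "L_oplus \<beta> = 2 \<and> L_otimes \<beta> = 2"
proof -
  interpret quadratic_unit m \<beta>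
    using assms by unfold_locales
  have "L_oplus \<beta> = enat 2"
    unfolding L_oplus_def
  proof (intro Inf_enat_image_eq)
    show "2 \<in> {l. \<forall>x \<in> nb_integers \<beta>. \<forall>y \<in> nb_integers \<beta>.
        x + y \<in> nb_Fin \<beta> \<longrightarrow> x + y \<in> nb_scaled_integers \<beta> l}"
      using sum_in_nb_scaled_integers by blast
  next
    fix l
    assume "l \<in> {l. \<forall>x \<in> nb_integers \<beta>. \<forall>y \<in> nb_integers \<beta>.
        x + y \<in> nb_Fin \<beta> \<longrightarrow> x + y \<in> nb_scaled_integers \<beta> l}"
    then show "2 \<le> l"
      using sum_witness nb_scaled_integers_ge_2 by blast
  qed
  moreover have "L_otimes \<beta> = enat 2"
    unfolding L_otimes_def
  proof (intro Inf_enat_image_eq)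
    show "2 \<in> {l. \<forall>x \<in> nb_integers \<beta>. \<forall>y \<in> nb_integers \<beta>.
        x * y \<in> nb_Fin \<beta> \<longrightarrow> x * y \<in> nb_scaled_integers \<beta> l}"
      using product_in_nb_scaled_integers by blast
  next
    fix l
    assume "l \<in> {l. \<forall>x \<in> nb_integers \<beta>. \<forall>y \<in> nb_integers \<beta>.
        x * y \<in> nb_Fin \<beta> \<longrightarrow> x * y \<in> nb_scaled_integers \<beta> l}"
    then show "2 \<le> l"
      using product_witness nb_scaled_integers_ge_2 by blast
  qed
  ultimately show ?thesis
    by (simp add: numeral_eq_enat)
qed

end
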